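(* For every non-negative integer $n$ and every integer $s$, \[ 2 \sum_{k = 0}^{\lfloor n/2 \rfloor} \binom {n}{2k} 4^k F_{2k + s} = \begin{cases} F_{3n + s} + 5^{n/2}F_s, & \text{$n$ even;}\\ F_{3n + s} - 5^{(n-1)/2}L_s, & \text{$n$ odd,} \end{cases} \qquad 2 \sum_{k = 0}^{\lfloor n/2 \rfloor} \binom {n}{2k} 4^k L_{2k + s} = \begin{cases} L_{3n + s} + 5^{n/2}L_s, & \text{$n$ even;}\\ L_{3n + s} - 5^{(n+1)/2}F_s, & \text{$n$ odd.} \end{cases} \]
   Context: The Fibonacci numbers $F_j$ and Lucas numbers $L_j$ are defined for all integers $j$ by $F_0=0$, $F_1=1$, $L_0=2$, $L_1=1$, $F_j=F_{j-1}+F_{j-2}$, $L_j=L_{j-1}+L_{j-2}$, with $F_{-j}=(-1)^{j-1}F_j$ and $L_{-j}=(-1)^jL_j$. *)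

theory Defs
  imports Main "HOL-Number_Theory.Fib"
begin

fun lucas :: "nat \<Rightarrow> nat" where
  "lucas 0 = 2"
| "lucas (Suc 0) = 1"
| "lucas (Suc (Suc n)) = lucas (Suc n) + lucas n"

definition fib_int :: "int \<Rightarrow> int" where
  "fib_int j = (if 0 \<le> j then int (fib (nat j))
                else (- 1) ^ (nat (- j) - 1) * int (fib (nat (- j))))"

definition lucas_int :: "int \<Rightarrow> int" where
  "lucas_int j = (if 0 \<le> j then int (lucas (nat j))
                  else (- 1) ^ nat (- j) * int (lucas (nat (- j))))"

lemma fib_int_0 [simp]: "fib_int 0 = 0"
  and fib_int_1 [simp]: "fib_int 1 = 1"
  and lucas_int_0 [simp]: "lucas_int 0 = 2"
  and lucas_int_1 [simp]: "lucas_int 1 = 1"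
  by (simp_all add: fib_int_def lucas_int_def)

lemma int_rec_cases:
  fixes j :: int
  obtains m where "j = int m + 2" | "j = 1" | "j = 0" | m where "j = - int m - 1"
proof -
  consider "j \<ge> 2" | "j = 1" | "j = 0" | "j \<le> - 1" by linarith
  then show thesis
  proof cases
    case 1
    then have "j = int (nat (j - 2)) + 2" by simp
    then show thesis by (rule that(1))
  next
    case 4
    then have "j = - int (nat (- j - 1)) - 1" by simp
    then show thesis by (rule that(4))
  qed (use that in auto)
qed

lemma fib_int_rec: "fib_int j = fib_int (j - 1) + fib_int (j - 2)"
proof (cases j rule: int_rec_cases)
  case (1 m)
  then have "nat j = Suc (Suc m)" "nat (j - 1) = Suc m" "nat (j - 2) = m" by auto
  then show ?thesis using 1 by (simp add: fib_int_def)
next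
  case (4 m)
  then have "nat (- j) = Suc m" "nat (- (j - 1)) = Suc (Suc m)"
    "nat (- (j - 2)) = Suc (Suc (Suc m))"
    "\<not> 0 \<le> j" "\<not> 0 \<le> j - 1" "\<not> 0 \<le> j - 2" by auto
  note * = this
  show ?thesis
    by (simp only: fib_int_def * if_False) (simp add: algebra_simps)
qed (simp_all add: fib_int_def numeral_2_eq_2)

lemma lucas_int_rec: "lucas_int j = lucas_int (j - 1) + lucas_int (j - 2)"
proof (cases j rule: int_rec_cases)
  case (1 m)
  then have "nat j = Suc (Suc m)" "nat (j - 1) = Suc m" "nat (j - 2) = m" by auto
  then show ?thesis using 1 by (simp add: lucas_int_def)
next
  case (4 m)
  then have "nat (- j) = Suc m" "nat (- (j - 1)) = Suc (Suc m)"
    "nat (- (j - 2)) = Suc (Suc (Suc m))"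
    "\<not> 0 \<le> j" "\<not> 0 \<le> j - 1" "\<not> 0 \<le> j - 2" by auto
  note * = this
  show ?thesis
    by (simp only: lucas_int_def * if_False) (simp add: algebra_simps)
qed (simp_all add: lucas_int_def numeral_2_eq_2)

end

theory Submission
  imports Defs
begin

text \<open>
  The sum over even indices is half of the sum of the binomial transforms
  \<open>\<Sum>k\<le>n. (n choose k) x^k G (k + s)\<close> at \<open>x = 2\<close> and \<open>x = -2\<close>. Such a transform
  is the \<open>n\<close>-th power of the operator that maps \<open>G\<close> to \<open>\<lambda>s. G s + x * G (s + 1)\<close>.
  For \<open>x = 2\<close> and a Fibonacci-type sequence this operator is the shift by 3,
  corresponding to \<open>1 + 2 * \<alpha> = \<alpha>^3\<close> for the golden ratio \<open>\<alpha>\<close>; for \<open>x = -2\<close> it maps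
  \<open>F\<close> to \<open>-L\<close> and \<open>L\<close> to \<open>-5 * F\<close>, corresponding to \<open>1 - 2 * \<alpha> = -sqrt 5\<close>.
\<close>

lemma lucas_int_eq_fib_int: "lucas_int s = 2 * fib_int (s + 1) - fib_int s"
proof -
  define P where "P t \<longleftrightarrow> lucas_int t = 2 * fib_int (t + 1) - fib_int t" for t
  \<comment> \<open>Two consecutive values let the second-order recurrence run in both
    directions.\<close>
  have "P s \<and> P (s + 1)"
  proof (induction s rule: int_induct [where k = 0])
    case base
    show ?case
      using fib_int_rec [of 2] by (simp add: P_def)
  next
    case (step1 i)
    then show ?case
      using fib_int_rec [of "i + 2"] fib_int_rec [of "i + 3"] lucas_int_rec [of "i + 2"]
      by (simp add: P_def algebra_simps)
  next
    case (step2 i)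
    then show ?case
      using fib_int_rec [of "i + 1"] fib_int_rec [of "i + 2"] lucas_int_rec [of "i + 1"]
      by (simp add: P_def algebra_simps)
  qed
  then show ?thesis
    by (simp add: P_def)
qed

text \<open>With this form at the shifted index, only \<open>fib_int s\<close> and
  \<open>fib_int (1 + s)\<close> remain in the induction for \<open>x = -2\<close>.\<close>

lemma lucas_int_eq_fib_int': "lucas_int (1 + s) = fib_int (1 + s) + 2 * fib_int s"
  using fib_int_rec [of "s + 2"] by (simp add: lucas_int_eq_fib_int add_ac)

text \<open>On the right the odd terms cancel and the even ones double.\<close>

lemma sum_even_indices:
  fixes f :: "nat \<Rightarrow> 'a::comm_ring_1"
  shows "2 * (\<Sum>k = 0..n div 2. f (2 * k)) = (\<Sum>k\<le>n. f k) + (\<Sum>k\<le>n. (- 1) ^ k * f k)"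
proof (induction n)
  case (Suc n)
  then show ?case
    by (cases "even n") (auto elim!: evenE oddE simp: algebra_simps)
qed simp

definition binomial_transform :: "'a \<Rightarrow> (int \<Rightarrow> 'a) \<Rightarrow> nat \<Rightarrow> int \<Rightarrow> 'a::comm_ring_1" where
  "binomial_transform x G n s = (\<Sum>k\<le>n. of_nat (n choose k) * x ^ k * G (int k + s))"

lemma binomial_transform_0 [simp]: "binomial_transform x G 0 s = G s"
  by (simp add: binomial_transform_def)

lemma binomial_transform_Suc:
  "binomial_transform x G (Suc n) s = binomial_transform x G n s + x * binomial_transform x G n (s + 1)"
proof -
  let ?f = "\<lambda>m k. of_nat (m choose k) * x ^ k * G (int k + s)"
  have "binomial_transform x G (Suc n) s = ?f n 0 + (\<Sum>k\<le>n. ?f (Suc n) (Suc k))"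
    unfolding binomial_transform_def by (subst sum.atMost_Suc_shift) simp
  \<comment> \<open>Pascal's rule splits each coefficient.\<close>
  also have "(\<Sum>k\<le>n. ?f (Suc n) (Suc k)) =
      (\<Sum>k\<le>n. ?f n (Suc k)) + x * binomial_transform x G n (s + 1)"
    unfolding binomial_transform_def sum_distrib_left sum.distrib [symmetric]
    by (rule sum.cong) (simp_all add: algebra_simps)
  also have "?f n 0 + ((\<Sum>k\<le>n. ?f n (Suc k)) + x * binomial_transform x G n (s + 1)) =
      (\<Sum>k\<le>Suc n. ?f n k) + x * binomial_transform x G n (s + 1)"
    by (subst sum.atMost_Suc_shift) (simp add: add.assoc)
  also have "(\<Sum>k\<le>Suc n. ?f n k) = binomial_transform x G n s"
    by (simp add: binomial_transform_def binomial_eq_0)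
  finally show ?thesis .
qed

lemma binomial_transform_2:
  assumes "\<And>j. G j = G (j - 1) + G (j - 2)"
  shows "binomial_transform 2 G n s = G (3 * int n + s)"
proof (induction n arbitrary: s)
  case (Suc n)
  then show ?case
    \<comment> \<open>With \<open>j = 3 * int n + s\<close>: G (j + 3) = G (j + 2) + G (j + 1) = G j
      + 2 * G (j + 1).\<close>
    using assms [of "3 * int n + s + 3"] assms [of "3 * int n + s + 2"]
    by (simp add: binomial_transform_Suc algebra_simps)
qed simp

text \<open>Two applications of the operator multiply by 5; for odd \<open>n\<close> one application
  is left over, and on L it contributes the extra factor 5.\<close>

lemma binomial_transform_minus_2:
  "binomial_transform (- 2) fib_int n s =
     (if even n then 5 ^ (n div 2) * fib_int s else - (5 ^ (n div 2)) * lucas_int s)"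
  "binomial_transform (- 2) lucas_int n s =
     (if even n then 5 ^ (n div 2) * lucas_int s else - (5 ^ Suc (n div 2)) * fib_int s)"
proof (induction n arbitrary: s)
  case (Suc n)
  {
    case (1 s)
    show ?case
      using Suc by (simp add: binomial_transform_Suc lucas_int_eq_fib_int' lucas_int_eq_fib_int [of s] algebra_simps)
  next
    case (2 s)
    show ?case
      using Suc by (simp add: binomial_transform_Suc lucas_int_eq_fib_int' lucas_int_eq_fib_int [of s] algebra_simps)
  }
qed simp_all

lemma sum_even_binomial:
  "2 * (\<Sum>k = 0..n div 2. int (n choose (2 * k)) * 4 ^ k * G (2 * int k + s)) =
     binomial_transform 2 G n s + binomial_transform (- 2) G n s"
proof -
  \<comment> \<open>Keeping \<open>2 ^ (2 * k)\<close> makes the summand an instance of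
    \<open>f (2 * k)\<close>; the alternating sum then has (-1)^k * 2^k = (-2)^k.\<close>
  have "2 * (\<Sum>k = 0..n div 2. int (n choose (2 * k)) * 2 ^ (2 * k) * G (int (2 * k) + s)) =
     binomial_transform 2 G n s + binomial_transform (- 2) G n s"
    using sum_even_indices [of "\<lambda>k. int (n choose k) * 2 ^ k * G (int k + s)" n]
    unfolding binomial_transform_def power_minus [of 2] by (simp add: mult_ac)
  then show ?thesis
    by (simp add: power_mult)
qed

theorem theorem11:
  fixes n :: nat and s :: int
  shows "2 * (\<Sum>k = 0..n div 2. int (n choose (2 * k)) * 4 ^ k * fib_int (2 * int k + s)) =
           (if even n then fib_int (3 * int n + s) + 5 ^ (n div 2) * fib_int s
            else fib_int (3 * int n + s) - 5 ^ ((n - 1) div 2) * lucas_int s)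
       \<and> 2 * (\<Sum>k = 0..n div 2. int (n choose (2 * k)) * 4 ^ k * lucas_int (2 * int k + s)) =
           (if even n then lucas_int (3 * int n + s) + 5 ^ (n div 2) * lucas_int s
            else lucas_int (3 * int n + s) - 5 ^ ((n + 1) div 2) * fib_int s)"
  unfolding sum_even_binomial binomial_transform_2 [OF fib_int_rec]
    binomial_transform_2 [OF lucas_int_rec] binomial_transform_minus_2
  by (auto elim!: oddE)

end
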